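(* Let $\bm{X}_E$ be a random vector in $\mathbb{R}^d_+$ with standard exponential margins and let $\bm{X}_E^1,\bm{X}_E^2,\ldots$ be independent copies of $\bm{X}_E$. Suppose that the sample cloud $N_n=\{\bm{X}_E^1/\log n,\ldots,\bm{X}_E^n/\log n\}$ converges in probability onto a limit set $G$, and that for each $\bm{\omega}\in\mathcal{S}_\Sigma=\{\bm{\omega}\in[0,1]^d:\sum_{j=1}^d\omega_j=1\}$, $$\mathbb{P}(\bm{X}_E>\bm{\omega}v)=\ell(e^v;\bm{\omega})\,e^{-\lambda(\bm{\omega})v},$$ where $\ell(\cdot;\bm{\omega})$ is slowly varying at infinity and $\lambda(\bm{\omega})\in[0,\infty)$. Then $$\lambda(\bm{\omega})=\max(\bm{\omega})\times r_{\bm{\omega}}^{-1},\qquad\text{where}\qquad r_{\bm{\omega}}=\min\{r\in[0,1]: rR_{\bm{\omega}}\cap G=\emptyset\}$$ and $$R_{\bm{\omega}}=\left(\frac{\omega_1}{\max(\omega_1,\ldots,\omega_d)},\infty\right]\times\cdots\times\left(\frac{\omega_d}{\max(\omega_1,\ldots,\omega_d)},\infty\right].$$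
   Context: A sequence of random non-empty compact sets $N_n\subset\mathbb{R}^d$ converges in probability onto a deterministic non-empty compact set $G$ (the limit set) if $d_H(N_n,G)\to0$ in probability, where $d_H$ is the Hausdorff distance. A function $\ell:\mathbb{R}_+\to\mathbb{R}_+$ is slowly varying at infinity if $\ell(tx)/\ell(t)\to1$ as $t\to\infty$ for every $x>0$. Inequalities between vectors are componentwise, $\max(\bm{\omega})=\max_j\omega_j$, and $rR_{\bm{\omega}}=\prod_{j}(r\omega_j/\max(\bm{\omega}),\infty]$. In terms of $\bm{X}_P=\exp(\bm{X}_E)$ (componentwise), which has standard Pareto margins, the displayed assumption reads $\mathbb{P}(\bm{X}_P>t^{\bm{\omega}})=\ell(t;\bm{\omega})t^{-\lambda(\bm{\omega})}$.
   Formalization: For coordinates with ω_j = 0, the factor (0,∞] of rR_ω is replaced by [0,∞]: with (0,∞] the identity fails, e.g. at ω=(1,0) for a G made of the segments from 0 to (1,0), (0,1) and (1/2,1/2). For ω with all ω_j > 0 nothing changes. Positivity of r_ω is also proved. *)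

theory Defs
  imports "HOL-Probability.Probability"
begin

definition hausdorff_dist :: "'a::metric_space set \<Rightarrow> 'a set \<Rightarrow> real" where
  "hausdorff_dist A B = max (SUP a\<in>A. infdist a B) (SUP b\<in>B. infdist b A)"

definition converges_in_prob_onto ::
    "'w measure \<Rightarrow> (nat \<Rightarrow> 'w \<Rightarrow> 'a::metric_space set) \<Rightarrow> 'a set \<Rightarrow> bool" where
  "converges_in_prob_onto M N G \<longleftrightarrow>
     compact G \<and> G \<noteq> {} \<and>
     (\<forall>e>0. (\<lambda>n. measure M {w \<in> space M. e < hausdorff_dist (N n w) G}) \<longlonglongrightarrow> 0)"

text \<open>
  For n = 0 the cloud is empty and for n = 1 the scaling factor is 1 / ln 1 = 1 / 0 = 0; neither
  value of n affects convergence as n tends to infinity.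
\<close>
definition sample_cloud :: "(nat \<Rightarrow> 'w \<Rightarrow> real ^ 'n) \<Rightarrow> nat \<Rightarrow> 'w \<Rightarrow> (real ^ 'n) set" where
  "sample_cloud Y n w = (\<lambda>i. (1 / ln (real n)) *\<^sub>R Y i w) ` {1..n}"

definition slowly_varying :: "(real \<Rightarrow> real) \<Rightarrow> bool" where
  "slowly_varying l \<longleftrightarrow>
     (\<forall>t\<ge>0. 0 \<le> l t) \<and> (\<forall>x>0. ((\<lambda>t. l (t * x) / l t) \<longlongrightarrow> 1) at_top)"

definition simplex_Sigma :: "(real ^ 'n) set" where
  "simplex_Sigma = {\<omega>. (\<forall>j. 0 \<le> \<omega> $ j \<and> \<omega> $ j \<le> 1) \<and> (\<Sum>j\<in>UNIV. \<omega> $ j) = 1}"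

definition max_coord :: "real ^ 'n \<Rightarrow> real" where
  "max_coord \<omega> = Max (range (\<lambda>j. \<omega> $ j))"

text \<open>
  The set r R for a direction \<omega>, where R is the product of the intervals (\<omega> $ j / max_coord \<omega>, \<infinity>]. Only its
  finite points are kept, since it is only ever intersected with a subset of Euclidean space. For
  r = 0 the product of the intervals (0, \<infinity>] is meant, not the image of R under multiplication by 0.

  A coordinate j with \<omega> $ j = 0 contributes the factor [0, \<infinity>] instead of (0, \<infinity>]: the event
  X j > \<omega> $ j * v is then almost sure and puts no constraint on coordinate j. With (0, \<infinity>] the
  identity of the theorem fails on the boundary of the simplex. For example, there is a vector
  with standard exponential margins that satisfies all hypotheses and whose limit set G consists
  of the segments from the origin to (1,0), (0,1) and (1/2,1/2). For \<omega> = (1,0) its rate is 1, as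
  it is for any such vector, whereas (r, \<infinity>] x (0, \<infinity>] misses G already for r = 1/2, so that the
  formula would give 2.
\<close>
definition scaled_R :: "real \<Rightarrow> real ^ 'n \<Rightarrow> (real ^ 'n) set" where
  "scaled_R r \<omega> =
     {x. \<forall>j. x $ j \<in> (if \<omega> $ j = 0 then {0..} else {r * \<omega> $ j / max_coord \<omega> <..})}"

lemma scaled_R_interior:
  assumes "\<And>j. 0 < \<omega> $ j"
  shows "scaled_R r \<omega> = {x. \<forall>j. r * \<omega> $ j / max_coord \<omega> < x $ j}"
  using assms by (simp add: scaled_R_def order_less_imp_not_eq2)

definition r_min :: "(real ^ 'n) set \<Rightarrow> real ^ 'n \<Rightarrow> real" where
  "r_min G \<omega> = (LEAST r. r \<in> {0..1} \<and> scaled_R r \<omega> \<inter> G = {})"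

end

theory Submission
  imports Defs "HOL-Real_Asymp.Real_Asymp"
begin

text \<open>
  Along the direction \<omega> the tail p v = P(X > \<omega> v) decreases and p (v + 1) / p v tends to
  exp (- lam \<omega>), so p v = exp (- lam \<omega> v + o(v)). Hence the expected number n p (s ln n) of points
  of the scaled cloud beyond s \<omega> tends to 0 if s > 1 / lam \<omega> and to infinity if s < 1 / lam \<omega>.
  In the first case the cloud misses the orthant beyond s \<omega>, so the limit set does not meet it. In
  the second case, by independence, the cloud hits it, so by compactness the limit set meets the
  closed orthant. The critical value of r is thus max \<omega> / lam \<omega>. It is at most 1, since the
  margins are exponential.
\<close>

section \<open>Regularly varying tails\<close>

text \<open>Write \<open>v = u + m\<close> with \<open>m\<close> a natural number and
  \<open>u\<close> in \<open>[V, V + 1)\<close>. The unit step is iterated \<open>m\<close> times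
  from \<open>u\<close>, and monotonicity bounds \<open>p u\<close> by \<open>p V\<close>.\<close>

lemma geometric_decay_upper:
  fixes p :: "real \<Rightarrow> real"
  assumes mono: "\<And>x y. V \<le> x \<Longrightarrow> x \<le> y \<Longrightarrow> p y \<le> p x"
    and step: "\<And>v. V \<le> v \<Longrightarrow> p (v + 1) \<le> exp c * p v"
    and nn: "0 \<le> p V"
  shows "\<exists>K\<ge>0. \<forall>v\<ge>V. p v \<le> K * exp (c * v)"
proof (intro exI conjI allI impI)
  \<comment> \<open>The factor \<open>exp \<bar>c\<bar>\<close> pays for rounding
    \<open>v - V\<close> down to an integer, whatever the sign of \<open>c\<close>;
    \<open>exp (- c * V)\<close> moves the origin of the decay from \<open>V\<close> to 0.\<close>
  show "0 \<le> p V * exp (\<bar>c\<bar> - c * V)" using nn by simp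
  have iter: "p (u + real m) \<le> exp (c * real m) * p u" if "V \<le> u" for u m
  proof (induction m)
    case (Suc m)
    have "p (u + real (Suc m)) \<le> exp c * p (u + real m)"
      using step[of "u + real m"] that by (simp add: add_ac)
    also have "\<dots> \<le> exp c * (exp (c * real m) * p u)"
      using Suc by (intro mult_left_mono) auto
    finally show ?case by (simp add: exp_add algebra_simps)
  qed simp
  fix v assume v: "V \<le> v"
  define m where "m = nat \<lfloor>v - V\<rfloor>"
  have m: "real m \<le> v - V" "v - V \<le> real m + 1"
    using v by (auto simp: m_def)
  have "p v \<le> exp (c * real m) * p (v - real m)"
    using iter[of "v - real m" m] m by simp
  also have "\<dots> \<le> exp (c * real m) * p V"
    using mono[of V "v - real m"] m by (intro mult_left_mono) auto
  also have "\<dots> \<le> exp (\<bar>c\<bar> - c * V + c * v) * p V"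
  proof -
    have "c * (real m - (v - V)) \<le> \<bar>c\<bar> * \<bar>real m - (v - V)\<bar>"
      by (metis abs_ge_self abs_mult)
    also have "\<dots> \<le> \<bar>c\<bar> * 1"
      using m by (intro mult_left_mono) auto
    finally show ?thesis using nn by (intro mult_right_mono) (auto simp: algebra_simps)
  qed
  finally show "p v \<le> p V * exp (\<bar>c\<bar> - c * V) * exp (c * v)"
    by (simp add: exp_add mult_ac)
qed

text \<open>The same iteration from below. On the starting window \<open>[V, V + 1)\<close> the
  decreasing \<open>p\<close> is at least \<open>p (V + 1)\<close>, hence positivity is asked for at
  that point.\<close>

lemma geometric_decay_lower:
  fixes p :: "real \<Rightarrow> real"
  assumes mono: "\<And>x y. V \<le> x \<Longrightarrow> x \<le> y \<Longrightarrow> p y \<le> p x"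
    and step: "\<And>v. V \<le> v \<Longrightarrow> exp c * p v \<le> p (v + 1)"
    and pos: "0 < p (V + 1)"
  shows "\<exists>K>0. \<forall>v\<ge>V. K * exp (c * v) \<le> p v"
proof (intro exI conjI allI impI)
  show "0 < p (V + 1) * exp (- \<bar>c\<bar> - c * V)" using pos by simp
  have iter: "exp (c * real m) * p u \<le> p (u + real m)" if "V \<le> u" for u m
  proof (induction m)
    case (Suc m)
    have "exp c * (exp (c * real m) * p u) \<le> exp c * p (u + real m)"
      using Suc by (intro mult_left_mono) auto
    also have "\<dots> \<le> p (u + real (Suc m))"
      using step[of "u + real m"] that by (simp add: add_ac)
    finally show ?case by (simp add: exp_add algebra_simps)
  qed simp
  fix v assume v: "V \<le> v"
  define m where "m = nat \<lfloor>v - V\<rfloor>"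
  have m: "real m \<le> v - V" "v - V \<le> real m + 1"
    using v by (auto simp: m_def)
  have "exp (- \<bar>c\<bar> - c * V + c * v) * p (V + 1) \<le> exp (c * real m) * p (V + 1)"
  proof -
    have "- (c * (real m - (v - V))) \<le> \<bar>c\<bar> * \<bar>real m - (v - V)\<bar>"
      by (metis abs_ge_minus_self abs_mult)
    also have "\<dots> \<le> \<bar>c\<bar> * 1"
      using m by (intro mult_left_mono) auto
    finally show ?thesis using pos by (intro mult_right_mono) (auto simp: algebra_simps)
  qed
  also have "\<dots> \<le> exp (c * real m) * p (v - real m)"
    using mono[of "v - real m" "V + 1"] m by (intro mult_left_mono) auto
  also have "\<dots> \<le> p v"
    using iter[of "v - real m" m] m by simp
  finally show "p (V + 1) * exp (- \<bar>c\<bar> - c * V) * exp (c * v) \<le> p v"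
    by (simp add: exp_add mult_ac)
qed

text \<open>Under \<open>t = exp v\<close> the multiplicative step \<open>x = exp 1\<close> in slow
  variation becomes the shift from \<open>v\<close> to \<open>v + 1\<close>.\<close>

lemma slowly_varying_tail_ratio:
  fixes p :: "real \<Rightarrow> real"
  assumes l: "slowly_varying l"
    and p: "\<And>v. 0 \<le> v \<Longrightarrow> p v = l (exp v) * exp (- b * v)"
  shows "((\<lambda>v. p (v + 1) / p v) \<longlongrightarrow> exp (- b)) at_top"
    and "eventually (\<lambda>v. 0 < p v) at_top"
proof -
  have lim: "((\<lambda>v. l (exp v * exp 1) / l (exp v)) \<longlongrightarrow> 1) at_top"
    using l exp_at_top unfolding slowly_varying_def
    by (intro filterlim_compose[of "\<lambda>t. l (t * exp 1) / l t" _ at_top exp]) auto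
  have "((\<lambda>v. l (exp v * exp 1) / l (exp v) * exp (- b)) \<longlongrightarrow> 1 * exp (- b)) at_top"
    by (intro tendsto_intros lim)
  moreover have "eventually (\<lambda>v. l (exp v * exp 1) / l (exp v) * exp (- b) = p (v + 1) / p v) at_top"
    using eventually_ge_at_top[of 0]
    by eventually_elim (simp add: p exp_add exp_minus exp_diff field_simps)
  ultimately show "((\<lambda>v. p (v + 1) / p v) \<longlongrightarrow> exp (- b)) at_top"
    using tendsto_cong by force
  \<comment> \<open>Since \<open>x / 0 = 0\<close>, a positive ratio rules out
    \<open>l (exp v) = 0\<close>.\<close>
  have "eventually (\<lambda>v. 0 < l (exp v * exp 1) / l (exp v)) at_top"
    using order_tendstoD(1)[OF lim, of 0] by simp
  with eventually_ge_at_top[of 0] show "eventually (\<lambda>v. 0 < p v) at_top"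
  proof eventually_elim
    case (elim v)
    have "0 \<le> l (exp v)" "l (exp v) \<noteq> 0"
      using l elim unfolding slowly_varying_def by auto
    then show ?case using elim by (simp add: p)
  qed
qed

text \<open>At \<open>v = s * ln n\<close> a bound \<open>K * exp (c * v)\<close> is
  \<open>K\<close> times the power \<open>c * s\<close> of \<open>n\<close>, so the product is at
  most of order \<open>n\<close> to the power \<open>1 + c * s\<close>. The strict inequality
  \<open>1 < b * s\<close> leaves room for the slowly varying factor.\<close>

lemma tail_at_log_small:
  fixes p :: "real \<Rightarrow> real"
  assumes mono: "\<And>x y. 0 \<le> x \<Longrightarrow> x \<le> y \<Longrightarrow> p y \<le> p x"
    and nn: "\<And>v. 0 \<le> p v"
    and l: "slowly_varying l"
    and p: "\<And>v. 0 \<le> v \<Longrightarrow> p v = l (exp v) * exp (- b * v)"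
    and s: "0 < s" "1 < b * s"
  shows "(\<lambda>n. real n * p (s * ln (real n))) \<longlonglongrightarrow> 0"
proof -
  have "- b < - (1 / s)" using s by (simp add: field_simps)
  \<comment> \<open>The lower bound on \<open>c\<close> puts the tail ratio eventually below
    \<open>exp c\<close>; the upper bound makes the exponent \<open>1 + c * s\<close>
    negative.\<close>
  then obtain c where c: "- b < c" "c < - (1 / s)" using dense by blast
  have cs: "1 + c * s < 0" using c s by (simp add: field_simps)
  have "eventually (\<lambda>v. p (v + 1) / p v < exp c) at_top"
    using slowly_varying_tail_ratio(1)[OF l p] c by (intro order_tendstoD(2)[of _ "exp (- b)"]) auto
  moreover have "eventually (\<lambda>v. 0 < p v) at_top"
    by (rule slowly_varying_tail_ratio(2)[OF l p])
  moreover note eventually_ge_at_top[of 0]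
  ultimately have "eventually (\<lambda>v. 0 \<le> v \<and> p (v + 1) \<le> exp c * p v) at_top"
    by eventually_elim (simp add: field_simps)
  then obtain V where V: "\<And>v. V \<le> v \<Longrightarrow> 0 \<le> v \<and> p (v + 1) \<le> exp c * p v"
    unfolding eventually_at_top_linorder by blast
  obtain K where K: "K \<ge> 0" "\<And>v. V \<le> v \<Longrightarrow> p v \<le> K * exp (c * v)"
    using geometric_decay_upper[of V p c] mono V nn by (metis order_refl)
  have lim: "(\<lambda>n. K * exp ((1 + c * s) * ln (real n))) \<longlonglongrightarrow> 0"
    using cs by real_asymp
  have slim: "filterlim (\<lambda>n. s * ln (real n)) at_top sequentially"
    using s(1) by real_asymp
  show ?thesis
  proof (rule tendsto_sandwich[OF _ _ tendsto_const lim])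
    show "eventually (\<lambda>n. real n * p (s * ln (real n)) \<le> K * exp ((1 + c * s) * ln (real n))) sequentially"
      using filterlim_at_top[THEN iffD1, OF slim, rule_format, of V] eventually_gt_at_top[of 0]
    proof eventually_elim
      case (elim n)
      have "real n * p (s * ln (real n)) \<le> exp (ln (real n)) * (K * exp (c * (s * ln (real n))))"
        using K elim by (simp add: mult_left_mono)
      also have "\<dots> = K * exp ((1 + c * s) * ln (real n))"
        unfolding ring_distribs exp_add by (simp add: mult_ac)
      finally show ?case .
    qed
  qed (simp add: nn)
qed

text \<open>Here \<open>c\<close> is taken slightly below \<open>- b\<close>, and
  \<open>b * s < 1\<close> keeps the exponent \<open>1 + c * s\<close> positive.\<close>

lemma tail_at_log_large:
  fixes p :: "real \<Rightarrow> real"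
  assumes mono: "\<And>x y. 0 \<le> x \<Longrightarrow> x \<le> y \<Longrightarrow> p y \<le> p x"
    and l: "slowly_varying l"
    and p: "\<And>v. 0 \<le> v \<Longrightarrow> p v = l (exp v) * exp (- b * v)"
    and s: "0 < s" "b * s < 1"
  shows "filterlim (\<lambda>n. real n * p (s * ln (real n))) at_top sequentially"
proof -
  have "- (1 / s) < - b" using s by (simp add: field_simps)
  then obtain c where c: "c < - b" "- (1 / s) < c" using dense by blast
  have cs: "0 < 1 + c * s" using c s by (simp add: field_simps)
  have "eventually (\<lambda>v. exp c < p (v + 1) / p v) at_top"
    using slowly_varying_tail_ratio(1)[OF l p] c by (intro order_tendstoD(1)[of _ "exp (- b)"]) auto
  moreover have "eventually (\<lambda>v. 0 < p v) at_top"
    by (rule slowly_varying_tail_ratio(2)[OF l p])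
  moreover note eventually_ge_at_top[of 0]
  ultimately have "eventually (\<lambda>v. 0 \<le> v \<and> 0 < p v \<and> exp c * p v \<le> p (v + 1)) at_top"
    by eventually_elim (simp add: field_simps)
  then obtain V where V: "\<And>v. V \<le> v \<Longrightarrow> 0 \<le> v \<and> 0 < p v \<and> exp c * p v \<le> p (v + 1)"
    unfolding eventually_at_top_linorder by blast
  obtain K where K: "K > 0" "\<And>v. V \<le> v \<Longrightarrow> K * exp (c * v) \<le> p v"
    using geometric_decay_lower[of V p c] mono V by (metis order_refl less_add_one less_imp_le)
  have lim: "filterlim (\<lambda>n. K * exp ((1 + c * s) * ln (real n))) at_top sequentially"
    using cs K(1) by real_asymp
  have slim: "filterlim (\<lambda>n. s * ln (real n)) at_top sequentially"
    using s(1) by real_asymp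
  show ?thesis
  proof (rule filterlim_at_top_mono[OF lim])
    show "eventually (\<lambda>n. K * exp ((1 + c * s) * ln (real n)) \<le> real n * p (s * ln (real n))) sequentially"
      using filterlim_at_top[THEN iffD1, OF slim, rule_format, of V] eventually_gt_at_top[of 0]
    proof eventually_elim
      case (elim n)
      have "K * exp ((1 + c * s) * ln (real n)) = exp (ln (real n)) * (K * exp (c * (s * ln (real n))))"
        unfolding ring_distribs exp_add by (simp add: mult_ac)
      also have "\<dots> \<le> real n * p (s * ln (real n))"
        using K elim by (simp add: mult_left_mono)
      finally show ?case .
    qed
  qed
qed

section \<open>Hausdorff distance of the sample cloud\<close>

lemma infdist_finite_gt_iff:
  assumes "finite A" "A \<noteq> {}"
  shows "e < infdist b A \<longleftrightarrow> (\<forall>a\<in>A. e < dist b a)"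
  using assms by (simp add: infdist_notempty finite_less_Inf_iff)

text \<open>A number strictly below a supremum is exceeded by some member. This replaces the suprema
  by quantifiers, which serve both for measurability and for extracting nearby points.\<close>

lemma hausdorff_dist_gt_iff:
  assumes A: "finite A" "A \<noteq> {}" and G: "compact G" "G \<noteq> {}"
  shows "e < hausdorff_dist A G \<longleftrightarrow>
    (\<exists>a\<in>A. e < infdist a G) \<or> (\<exists>b\<in>G. \<forall>a\<in>A. e < dist b a)"
proof -
  \<comment> \<open>A real \<open>SUP\<close> is meaningful only for sets bounded above; compactness
    of \<open>G\<close> supplies the bound.\<close>
  have "compact ((\<lambda>b. infdist b A) ` G)"
    using G by (intro compact_continuous_image continuous_intros)
  then have "bdd_above ((\<lambda>b. infdist b A) ` G)"
    by (intro bounded_imp_bdd_above compact_imp_bounded)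
  then show ?thesis
    using A G by (simp add: hausdorff_dist_def less_max_iff_disj less_cSUP_iff infdist_finite_gt_iff)
qed

text \<open>Being farther than \<open>e\<close> from each of finitely many points is an open
  condition, so a solution in \<open>G\<close> yields one in \<open>D\<close>. With \<open>D\<close>
  countable, the event becomes a countable union.\<close>

lemma dense_subset_far_point_iff:
  assumes A: "finite A" and D: "D \<subseteq> G" "G \<subseteq> closure D"
  shows "(\<exists>b\<in>G. \<forall>a\<in>A. e < dist b a) \<longleftrightarrow> (\<exists>b\<in>D. \<forall>a\<in>A. e < dist b a)"
proof
  assume "\<exists>b\<in>G. \<forall>a\<in>A. e < dist b a"
  moreover have "open {b. \<forall>a\<in>A. e < dist b a}"
  proof -
    have "{b. \<forall>a\<in>A. e < dist b a} = (\<Inter>a\<in>A. {b. e < dist b a})" by auto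
    also have "open \<dots>"
      using A by (intro open_INT ballI open_Collect_less continuous_intros)
    finally show ?thesis .
  qed
  ultimately show "\<exists>b\<in>D. \<forall>a\<in>A. e < dist b a"
    using open_Int_closure_eq_empty[of "{b. \<forall>a\<in>A. e < dist b a}" D] D by blast
qed (use D in blast)

text \<open>
  The measure of a non-measurable set is 0 by convention, so convergence in probability carries
  information only once its events are known to be measurable.
\<close>

lemma sample_cloud_hausdorff_gt_measurable:
  fixes Y :: "nat \<Rightarrow> 'w \<Rightarrow> real ^ 'n"
  assumes Y: "\<And>i. 1 \<le> i \<Longrightarrow> Y i \<in> borel_measurable M"
    and G: "compact G" "G \<noteq> {}" and n: "1 \<le> n"
  shows "{w \<in> space M. e < hausdorff_dist (sample_cloud Y n w) G} \<in> sets M"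
proof -
  obtain D where D: "countable D" "D \<subseteq> G" "G \<subseteq> closure D"
    using separable[of G] by metis
  have cloud: "finite (sample_cloud Y n w)" "sample_cloud Y n w \<noteq> {}" for w
    using n by (auto simp: sample_cloud_def)
  have "{w \<in> space M. e < hausdorff_dist (sample_cloud Y n w) G} =
      {w \<in> space M. (\<exists>i\<in>{1..n}. e < infdist ((1 / ln (real n)) *\<^sub>R Y i w) G) \<or>
        (\<exists>b\<in>D. \<forall>i\<in>{1..n}. e < dist b ((1 / ln (real n)) *\<^sub>R Y i w))}"
    by (simp add: hausdorff_dist_gt_iff[OF cloud G]
      dense_subset_far_point_iff[OF cloud(1) D(2,3)]) (simp add: sample_cloud_def)
  also have "\<dots> \<in> sets M"
  proof (rule sets.sets_Collect_disj)
    have Y': "(\<lambda>w. (1 / ln (real n)) *\<^sub>R Y i w) \<in> borel_measurable M" if "i \<in> {1..n}" for i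
      using that by (intro borel_measurable_scaleR borel_measurable_const Y) auto
    have "{w \<in> space M. e < infdist ((1 / ln (real n)) *\<^sub>R Y i w) G} \<in> sets M" if "i \<in> {1..n}" for i
    proof -
      have "(\<lambda>w. infdist ((1 / ln (real n)) *\<^sub>R Y i w) G) \<in> borel_measurable M"
        by (rule measurable_compose[OF Y'[OF that] borel_measurable_continuous_onI])
          (intro continuous_intros)
      then show ?thesis by measurable
    qed
    then show "{w \<in> space M. \<exists>i\<in>{1..n}. e < infdist ((1 / ln (real n)) *\<^sub>R Y i w) G} \<in> sets M"
      by (rule sets.sets_Collect_finite_Ex) auto
    have "{w \<in> space M. e < dist b ((1 / ln (real n)) *\<^sub>R Y i w)} \<in> sets M" if "i \<in> {1..n}" for i b
      using borel_measurable_dist[OF borel_measurable_const Y'[OF that]] by measurable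
    then have "{w \<in> space M. \<forall>i\<in>{1..n}. e < dist b ((1 / ln (real n)) *\<^sub>R Y i w)} \<in> sets M" for b
      using n by (intro sets.sets_Collect_finite_All') auto
    then show "{w \<in> space M. \<exists>b\<in>D. \<forall>i\<in>{1..n}. e < dist b ((1 / ln (real n)) *\<^sub>R Y i w)} \<in> sets M"
      by (rule sets.sets_Collect_countable_Ex') (rule D(1))
  qed
  finally show ?thesis .
qed

text \<open>Two events whose probabilities tend to 0 cannot cover the space for large
  \<open>n\<close>. An outcome outside both reduces the later arguments to one deterministic cloud;
  \<open>2 \<le> n\<close> makes the scaling \<open>ln n\<close> positive.\<close>

lemma (in prob_space) exists_close_sample:
  fixes Y :: "nat \<Rightarrow> 'a \<Rightarrow> real ^ 'n"
  assumes Y: "\<And>i. 1 \<le> i \<Longrightarrow> Y i \<in> borel_measurable M"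
    and conv: "converges_in_prob_onto M (sample_cloud Y) G"
    and B: "\<And>n. B n \<in> events" "(\<lambda>n. prob (B n)) \<longlonglongrightarrow> 0"
    and d: "0 < d"
  shows "\<exists>n w. 2 \<le> n \<and> w \<in> space M - B n \<and>
    (\<forall>i\<in>{1..n}. \<exists>g\<in>G. dist ((1 / ln (real n)) *\<^sub>R Y i w) g \<le> d) \<and>
    (\<forall>g\<in>G. \<exists>i\<in>{1..n}. dist g ((1 / ln (real n)) *\<^sub>R Y i w) \<le> d)"
proof -
  have G: "compact G" "G \<noteq> {}" using conv by (auto simp: converges_in_prob_onto_def)
  define F where "F n = {w \<in> space M. d < hausdorff_dist (sample_cloud Y n w) G}" for n
  have "(\<lambda>n. prob (F n)) \<longlonglongrightarrow> 0"
    using conv d by (simp add: converges_in_prob_onto_def F_def)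
  then have "(\<lambda>n. prob (F n) + prob (B n)) \<longlonglongrightarrow> 0 + 0"
    by (intro tendsto_add B)
  then have "eventually (\<lambda>n. prob (F n) + prob (B n) < 1) sequentially"
    by (intro order_tendstoD) auto
  then have "eventually (\<lambda>n. prob (F n) + prob (B n) < 1 \<and> 2 \<le> n) sequentially"
    using eventually_ge_at_top[of 2] by eventually_elim auto
  then obtain n where n: "prob (F n) + prob (B n) < 1" "2 \<le> n"
    unfolding eventually_sequentially by blast
  have ev: "F n \<in> events"
    unfolding F_def using Y G n(2) by (intro sample_cloud_hausdorff_gt_measurable) auto
  have "prob (F n \<union> B n) < 1"
    using n(1) ev B(1)[of n] measure_Un_le[of "F n" M "B n"] by linarith
  then have "F n \<union> B n \<noteq> space M" by (auto simp: prob_space)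
  moreover have "F n \<union> B n \<subseteq> space M" using sets.sets_into_space[OF B(1)[of n]] by (auto simp: F_def)
  ultimately obtain w where w: "w \<in> space M" "w \<notin> F n" "w \<notin> B n" by auto
  have "\<not> d < hausdorff_dist (sample_cloud Y n w) G" using w by (simp add: F_def)
  then have *: "\<forall>i\<in>{1..n}. infdist ((1 / ln (real n)) *\<^sub>R Y i w) G \<le> d"
     "\<forall>g\<in>G. \<exists>i\<in>{1..n}. dist g ((1 / ln (real n)) *\<^sub>R Y i w) \<le> d"
    using n(2) G by (auto simp: hausdorff_dist_gt_iff sample_cloud_def not_less)
  \<comment> \<open>The infimum over the compact \<open>G\<close> is attained, so no slack has to be
    added to \<open>d\<close>.\<close>
  have "\<exists>g\<in>G. dist ((1 / ln (real n)) *\<^sub>R Y i w) g \<le> d" if "i \<in> {1..n}" for i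
    using infdist_attains_inf[OF compact_imp_closed[OF G(1)] G(2), of "(1 / ln (real n)) *\<^sub>R Y i w"]
      *(1) that by metis
  with * w n(2) show ?thesis by blast
qed

section \<open>Hitting probabilities of samples\<close>

text \<open>Independence gives the product \<open>(1 - q) ^ n\<close>, and
  \<open>1 - q \<le> exp (- q)\<close>. The bound vanishes when the expected number of hits tends to
  infinity.\<close>

lemma (in prob_space) prob_no_hit_le:
  assumes ind: "indep_vars (\<lambda>_. N) Y {1..}"
    and A: "A \<in> sets N" and q: "\<And>i. 1 \<le> i \<Longrightarrow> prob (Y i -` A \<inter> space M) = q"
    and n: "1 \<le> n"
  shows "prob {w \<in> space M. \<forall>i\<in>{1..n}. Y i w \<notin> A} \<le> exp (- (real n * q))"
proof -
  have Y: "Y i \<in> measurable M N" if "1 \<le> i" for i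
    using ind that by (simp add: indep_vars_def)
  have compl: "prob (Y i -` (space N - A) \<inter> space M) = 1 - q" if "1 \<le> i" for i
  proof -
    have "Y i -` (space N - A) \<inter> space M = space M - (Y i -` A \<inter> space M)"
      using measurable_space[OF Y[OF that]] by auto
    then show ?thesis
      using prob_compl[OF measurable_sets[OF Y[OF that] A]] q[OF that] by simp
  qed
  \<comment> \<open>The index set must be nonempty: an empty intersection would be
    \<open>UNIV\<close> instead of \<open>space M\<close>.\<close>
  have "{w \<in> space M. \<forall>i\<in>{1..n}. Y i w \<notin> A} = (\<Inter>i\<in>{1..n}. Y i -` (space N - A) \<inter> space M)"
    using n measurable_space[OF Y] by fastforce
  also have "prob \<dots> = (\<Prod>i\<in>{1..n}. prob (Y i -` (space N - A) \<inter> space M))"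
    using n A by (intro indep_varsD[OF ind]) auto
  also have "\<dots> = (1 - q) ^ n" using compl by simp
  \<comment> \<open>Reading \<open>q\<close> as a probability gives \<open>q \<le> 1\<close>, so the
    base \<open>1 - q\<close> is nonnegative and powers are monotone.\<close>
  also have "\<dots> \<le> exp (- q) ^ n"
    using exp_ge_add_one_self[of "- q"] q[of 1, symmetric] by (intro power_mono) auto
  finally show ?thesis by (simp add: exp_of_nat_mult[symmetric])
qed

text \<open>Union bound: the expected number of hits dominates the probability of a hit.\<close>

lemma (in prob_space) prob_hit_le:
  assumes Y: "\<And>i. 1 \<le> i \<Longrightarrow> Y i \<in> measurable M N"
    and A: "A \<in> sets N" and q: "\<And>i. 1 \<le> i \<Longrightarrow> prob (Y i -` A \<inter> space M) = q"
  shows "prob {w \<in> space M. \<exists>i\<in>{1..n}. Y i w \<in> A} \<le> real n * q"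
proof -
  have "{w \<in> space M. \<exists>i\<in>{1..n}. Y i w \<in> A} = (\<Union>i\<in>{1..n}. Y i -` A \<inter> space M)" by auto
  also have "prob \<dots> \<le> (\<Sum>i\<in>{1..n}. prob (Y i -` A \<inter> space M))"
    using measurable_sets[OF Y A] by (intro finite_measure_subadditive_finite) auto
  also have "\<dots> = real n * q" using q by simp
  finally show ?thesis .
qed

section \<open>Orthants met or missed by the limit set\<close>

text \<open>If the compact \<open>G\<close> missed the closed orthant, the two would be a positive
  distance apart. Yet with probability tending to 1 some scaled sample point lies in the orthant
  while the whole cloud is close to \<open>G\<close>.\<close>

lemma (in prob_space) limit_set_meets_closed_orthant:
  fixes Y :: "nat \<Rightarrow> 'a \<Rightarrow> real ^ 'n"
  assumes ind: "indep_vars (\<lambda>_. borel) Y {1..}"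
    and Y: "\<And>i. 1 \<le> i \<Longrightarrow> distr M borel (Y i) = distr M borel X"
    and X: "X \<in> borel_measurable M"
    and conv: "converges_in_prob_onto M (sample_cloud Y) G"
    and lim: "filterlim (\<lambda>n. real n * prob {w \<in> space M. \<forall>j. \<omega> $ j * (s * ln (real n)) < X w $ j})
      at_top sequentially"
  shows "\<exists>g\<in>G. \<forall>j. \<omega> $ j * s \<le> g $ j"
proof (rule ccontr)
  assume contra: "\<not> ?thesis"
  have YM: "Y i \<in> borel_measurable M" if "1 \<le> i" for i
    using ind that by (simp add: indep_vars_def)
  define F where "F = {x :: real ^ 'n. \<forall>j. \<omega> $ j * s \<le> x $ j}"
  have "closed F"
    unfolding F_def by (intro closed_Collect_all closed_Collect_le continuous_intros)
  moreover have "compact G" using conv by (simp add: converges_in_prob_onto_def)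
  moreover have "G \<inter> F = {}" using contra by (auto simp: F_def)
  ultimately obtain d where d: "0 < d" "\<And>x y. x \<in> G \<Longrightarrow> y \<in> F \<Longrightarrow> d \<le> dist x y"
    using separate_compact_closed by metis
  \<comment> \<open>The orthant for unscaled points: dividing by \<open>ln n > 0\<close> carries
    \<open>A n\<close> into \<open>F\<close>.\<close>
  define A where "A n = {x :: real ^ 'n. \<forall>j. \<omega> $ j * (s * ln (real n)) < x $ j}" for n :: nat
  have A: "A n \<in> sets borel" for n
  proof -
    have "A n = (\<Inter>j. {x. \<omega> $ j * (s * ln (real n)) < x $ j})" by (auto simp: A_def)
    also have "open \<dots>" by (intro open_INT ballI open_Collect_less continuous_intros) simp
    finally show ?thesis by (rule borel_open)
  qed
  have q: "prob (Y i -` A n \<inter> space M) = prob {w \<in> space M. \<forall>j. \<omega> $ j * (s * ln (real n)) < X w $ j}"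
    if "1 \<le> i" for i n
  proof -
    have "prob (Y i -` A n \<inter> space M) = prob (X -` A n \<inter> space M)"
      using measure_distr[OF YM[OF that] A] measure_distr[OF X A] Y[OF that] by metis
    also have "X -` A n \<inter> space M = {w \<in> space M. \<forall>j. \<omega> $ j * (s * ln (real n)) < X w $ j}"
      by (auto simp: A_def)
    finally show ?thesis .
  qed
  define B where "B n = {w \<in> space M. \<forall>i\<in>{1..n}. Y i w \<notin> A n}" for n
  have B: "B n \<in> events" for n
  proof -
    have "{w \<in> space M. \<exists>i\<in>{1..n}. Y i w \<in> A n} \<in> events"
      using measurable_sets_Collect[OF YM, of _ "\<lambda>x. x \<in> A n"] A
      by (intro sets.sets_Collect_finite_Ex) auto
    from sets.compl_sets[OF this] show ?thesis
      by (rule back_subst[of "\<lambda>S. S \<in> events"]) (auto simp: B_def)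
  qed
  have "(\<lambda>n. prob (B n)) \<longlonglongrightarrow> 0"
  proof (rule tendsto_sandwich[OF _ _ tendsto_const])
    show "eventually (\<lambda>n. prob (B n) \<le>
        exp (- (real n * prob {w \<in> space M. \<forall>j. \<omega> $ j * (s * ln (real n)) < X w $ j}))) sequentially"
      using eventually_ge_at_top[of 1]
    proof eventually_elim
      case (elim n)
      show ?case unfolding B_def by (rule prob_no_hit_le[OF ind A q elim])
    qed
    show "(\<lambda>n. exp (- (real n * prob {w \<in> space M. \<forall>j. \<omega> $ j * (s * ln (real n)) < X w $ j}))) \<longlonglongrightarrow> 0"
      using lim by (intro filterlim_compose[OF exp_at_bot]) (simp add: filterlim_uminus_at_top)
  qed simp
  \<comment> \<open>Half of the gap, because the separation \<open>d \<le> dist x y\<close> is not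
    strict.\<close>
  from exists_close_sample[OF YM conv B this, of "d / 2"] d(1)
  obtain n w where nw: "2 \<le> n" "w \<in> space M - B n"
    "\<forall>i\<in>{1..n}. \<exists>g\<in>G. dist ((1 / ln (real n)) *\<^sub>R Y i w) g \<le> d / 2"
    by (metis half_gt_zero)
  then obtain i where i: "i \<in> {1..n}" "Y i w \<in> A n" by (auto simp: B_def)
  then obtain g where g: "g \<in> G" "dist ((1 / ln (real n)) *\<^sub>R Y i w) g \<le> d / 2" using nw by blast
  have "0 < ln (real n)" using nw(1) by simp
  then have "(1 / ln (real n)) *\<^sub>R Y i w \<in> F"
    using i(2) by (auto simp: A_def F_def field_simps intro: less_imp_le)
  with d g show False by (fastforce simp: dist_commute)
qed

text \<open>A point of \<open>G\<close> inside the open orthant has a ball around it there, and a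
  cloud close to \<open>G\<close> puts a sample point into that ball, although hits become
  improbable. The index set \<open>J\<close> allows only the coordinates with
  \<open>\<omega> $ j \<noteq> 0\<close> to be constrained, so that points of \<open>G\<close> on
  coordinate faces are covered.\<close>

lemma (in prob_space) limit_set_avoids_open_orthant:
  fixes Y :: "nat \<Rightarrow> 'a \<Rightarrow> real ^ 'n"
  assumes YM: "\<And>i. 1 \<le> i \<Longrightarrow> Y i \<in> borel_measurable M"
    and Y: "\<And>i. 1 \<le> i \<Longrightarrow> distr M borel (Y i) = distr M borel X"
    and X: "X \<in> borel_measurable M"
    and conv: "converges_in_prob_onto M (sample_cloud Y) G"
    and lim: "(\<lambda>n. real n * prob {w \<in> space M. \<forall>j\<in>J. \<omega> $ j * (s * ln (real n)) < X w $ j}) \<longlonglongrightarrow> 0"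
    and g: "g \<in> G" "\<And>j. j \<in> J \<Longrightarrow> \<omega> $ j * s < g $ j"
  shows False
proof -
  define U where "U = {x :: real ^ 'n. \<forall>j\<in>J. \<omega> $ j * s < x $ j}"
  have "open U"
  proof -
    have "U = (\<Inter>j\<in>J. {x. \<omega> $ j * s < x $ j})" by (auto simp: U_def)
    also have "open \<dots>" by (intro open_INT ballI open_Collect_less continuous_intros) simp
    finally show ?thesis .
  qed
  moreover have "g \<in> U" using g by (simp add: U_def)
  \<comment> \<open>A closed ball matches the non-strict closeness bound for the cloud.\<close>
  ultimately obtain d where d: "0 < d" "cball g d \<subseteq> U" by (meson open_contains_cball)
  define A where "A n = {x :: real ^ 'n. \<forall>j\<in>J. \<omega> $ j * (s * ln (real n)) < x $ j}" for n :: nat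
  have A: "A n \<in> sets borel" for n
  proof -
    have "A n = (\<Inter>j\<in>J. {x. \<omega> $ j * (s * ln (real n)) < x $ j})" by (auto simp: A_def)
    also have "open \<dots>" by (intro open_INT ballI open_Collect_less continuous_intros) simp
    finally show ?thesis by (rule borel_open)
  qed
  have q: "prob (Y i -` A n \<inter> space M) = prob {w \<in> space M. \<forall>j\<in>J. \<omega> $ j * (s * ln (real n)) < X w $ j}"
    if "1 \<le> i" for i n
  proof -
    have "prob (Y i -` A n \<inter> space M) = prob (X -` A n \<inter> space M)"
      using measure_distr[OF YM[OF that] A] measure_distr[OF X A] Y[OF that] by metis
    also have "X -` A n \<inter> space M = {w \<in> space M. \<forall>j\<in>J. \<omega> $ j * (s * ln (real n)) < X w $ j}"
      by (auto simp: A_def)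
    finally show ?thesis .
  qed
  define B where "B n = {w \<in> space M. \<exists>i\<in>{1..n}. Y i w \<in> A n}" for n
  have B: "B n \<in> events" for n
    unfolding B_def using measurable_sets_Collect[OF YM, of _ "\<lambda>x. x \<in> A n"] A
    by (intro sets.sets_Collect_finite_Ex) auto
  have "(\<lambda>n. prob (B n)) \<longlonglongrightarrow> 0"
    unfolding B_def
  proof (rule tendsto_sandwich[OF _ _ tendsto_const lim])
    show "eventually (\<lambda>n. prob {w \<in> space M. \<exists>i\<in>{1..n}. Y i w \<in> A n} \<le>
        real n * prob {w \<in> space M. \<forall>j\<in>J. \<omega> $ j * (s * ln (real n)) < X w $ j}) sequentially"
      by (intro always_eventually allI prob_hit_le[OF YM A q])
  qed simp
  from exists_close_sample[OF YM conv B this d(1)]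
  obtain n w where nw: "2 \<le> n" "w \<in> space M - B n"
    "\<forall>g\<in>G. \<exists>i\<in>{1..n}. dist g ((1 / ln (real n)) *\<^sub>R Y i w) \<le> d"
    by blast
  then obtain i where i: "i \<in> {1..n}" "dist g ((1 / ln (real n)) *\<^sub>R Y i w) \<le> d"
    using g(1) by blast
  then have "(1 / ln (real n)) *\<^sub>R Y i w \<in> U" using d(2) by auto
  moreover have "0 < ln (real n)" using nw(1) by simp
  ultimately have "Y i w \<in> A n" by (auto simp: A_def U_def field_simps)
  with nw i show False by (auto simp: B_def)
qed

section \<open>The critical radius\<close>

lemma max_coord_attained: "\<exists>j. \<omega> $ j = max_coord \<omega>"
proof -
  have "max_coord \<omega> \<in> range (\<lambda>j. \<omega> $ j)"
    unfolding max_coord_def by (rule Max_in) auto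
  then show ?thesis by auto
qed

lemma max_coord_pos:
  assumes "\<omega> \<in> simplex_Sigma"
  shows "0 < max_coord \<omega>"
proof (rule ccontr)
  assume "\<not> 0 < max_coord \<omega>"
  moreover have "\<omega> $ j \<le> max_coord \<omega>" for j by (simp add: max_coord_def)
  ultimately have "(\<Sum>j\<in>UNIV. \<omega> $ j) \<le> 0" by (intro sum_nonpos) (meson order_trans not_less)
  with assms show False by (simp add: simplex_Sigma_def)
qed

text \<open>The substitution \<open>r = s * max_coord \<omega>\<close> turns the threshold
  \<open>s = 1 / b\<close> into \<open>max_coord \<omega> / b\<close>, which \<open>lam\<close>
  places in \<open>[0, 1]\<close>. The assumptions concern \<open>s\<close> strictly on either side
  of the threshold; openness settles the threshold itself, so the minimum is attained.\<close>

lemma r_min_eqI: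
  assumes \<omega>: "\<omega> \<in> simplex_Sigma"
    and lam: "max_coord \<omega> \<le> b"
    and avoid: "\<And>s g. 1 < b * s \<Longrightarrow> g \<in> G \<Longrightarrow> (\<And>j. \<omega> $ j \<noteq> 0 \<Longrightarrow> \<omega> $ j * s < g $ j) \<Longrightarrow> False"
    and meet: "\<And>s. 0 < s \<Longrightarrow> b * s < 1 \<Longrightarrow> \<exists>g\<in>G. \<forall>j. \<omega> $ j * s \<le> g $ j"
  shows "r_min G \<omega> = max_coord \<omega> / b"
  unfolding r_min_def
proof (rule Least_equality)
  define m where "m = max_coord \<omega>"
  have m: "0 < m" "m \<le> b" using max_coord_pos[OF \<omega>] lam by (auto simp: m_def)
  have nn: "0 \<le> \<omega> $ j" for j using \<omega> by (simp add: simplex_Sigma_def)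
  have False if g: "g \<in> G" "g \<in> scaled_R (m / b) \<omega>" for g
  proof -
    \<comment> \<open>The strict inequalities at \<open>s = 1 / b\<close> persist slightly to the
      right; with finitely many coordinates one \<open>s\<close> serves all of them.\<close>
    have "eventually (\<lambda>s. \<omega> $ j \<noteq> 0 \<longrightarrow> \<omega> $ j * s < g $ j) (at_right (1 / b))" for j
    proof (cases "\<omega> $ j = 0")
      case False
      have "((\<lambda>s. \<omega> $ j * s) \<longlongrightarrow> \<omega> $ j * (1 / b)) (at_right (1 / b))"
        by (intro tendsto_intros)
      moreover have "\<omega> $ j * (1 / b) < g $ j"
        using g(2) False m by (auto simp: scaled_R_def m_def[symmetric] dest!: spec[of _ j])
      ultimately show ?thesis using order_tendstoD(2) by fastforce
    qed simp
    then have "eventually (\<lambda>s. \<forall>j. \<omega> $ j \<noteq> 0 \<longrightarrow> \<omega> $ j * s < g $ j) (at_right (1 / b))"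
      by (rule eventually_all_finite)
    with eventually_at_right_less have "eventually (\<lambda>s. 1 / b < s \<and> (\<forall>j. \<omega> $ j \<noteq> 0 \<longrightarrow> \<omega> $ j * s < g $ j)) (at_right (1 / b))"
      by (rule eventually_conj)
    then obtain s where s: "1 / b < s" "\<forall>j. \<omega> $ j \<noteq> 0 \<longrightarrow> \<omega> $ j * s < g $ j"
      using eventually_happens'[OF trivial_limit_at_right_real] by blast
    then show False using avoid[of s g] g m by (auto simp: field_simps)
  qed
  then show "max_coord \<omega> / b \<in> {0..1} \<and> scaled_R (max_coord \<omega> / b) \<omega> \<inter> G = {}"
    using m by (auto simp: m_def[symmetric])
  fix r assume r: "r \<in> {0..1} \<and> scaled_R r \<omega> \<inter> G = {}"
  show "max_coord \<omega> / b \<le> r"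
  proof (rule ccontr)
    assume "\<not> max_coord \<omega> / b \<le> r"
    then have "r / m < 1 / b" using m by (simp add: field_simps m_def[symmetric])
    \<comment> \<open>The gap between \<open>r / m\<close> and \<open>s\<close> turns the closed
      condition at \<open>s\<close> into the strict one at \<open>r\<close> wherever
      \<open>\<omega> $ j > 0\<close>.\<close>
    then obtain s where s: "r / m < s" "s < 1 / b" using dense by blast
    moreover have "0 \<le> r / m" using r m by simp
    ultimately have s': "0 < s" "b * s < 1" using m by (linarith, simp add: field_simps)
    from meet[OF s'] obtain g where g: "g \<in> G" "\<And>j. \<omega> $ j * s \<le> g $ j" by blast
    have "r * \<omega> $ j / max_coord \<omega> < g $ j" if "\<omega> $ j \<noteq> 0" for j
    proof -
      have "\<omega> $ j * (r / m) < \<omega> $ j * s" using nn[of j] that s by (intro mult_strict_left_mono) auto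
      with g(2)[of j] show ?thesis by (simp add: m_def mult.commute)
    qed
    \<comment> \<open>On a zero coordinate only a non-strict bound is available, which is what the
      factor \<open>{0..}\<close> of \<open>scaled_R\<close> asks for.\<close>
    moreover have "0 \<le> g $ j" if "\<omega> $ j = 0" for j using g(2)[of j] that by simp
    ultimately have "g \<in> scaled_R r \<omega>" by (auto simp: scaled_R_def)
    with g r show False by blast
  qed
qed

theorem proposition7:
  fixes M :: "'w measure"
    and X :: "'w \<Rightarrow> real ^ 'n"
    and Y :: "nat \<Rightarrow> 'w \<Rightarrow> real ^ 'n"
    and G :: "(real ^ 'n) set"
    and lam :: "real ^ 'n \<Rightarrow> real"
    and l :: "real ^ 'n \<Rightarrow> real \<Rightarrow> real"
  assumes "prob_space M"
    and "X \<in> borel_measurable M"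
    and "\<And>w j. w \<in> space M \<Longrightarrow> 0 \<le> X w $ j"
    and "\<And>j. distributed M lborel (\<lambda>w. X w $ j) (exponential_density 1)"
    and "prob_space.indep_vars M (\<lambda>_. borel) Y {1..}"
    and "\<And>i. 1 \<le> i \<Longrightarrow> distr M borel (Y i) = distr M borel X"
    and "converges_in_prob_onto M (sample_cloud Y) G"
    and "\<And>\<omega>. \<omega> \<in> simplex_Sigma \<Longrightarrow> slowly_varying (l \<omega>)"
    and "\<And>\<omega>. \<omega> \<in> simplex_Sigma \<Longrightarrow> 0 \<le> lam \<omega>"
    and "\<And>\<omega> v. \<omega> \<in> simplex_Sigma \<Longrightarrow> 0 \<le> v \<Longrightarrow>
           measure M {w \<in> space M. \<forall>j. \<omega> $ j * v < X w $ j} = l \<omega> (exp v) * exp (- lam \<omega> * v)"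
  shows "\<forall>\<omega>\<in>simplex_Sigma. 0 < r_min G \<omega> \<and> lam \<omega> = max_coord \<omega> * inverse (r_min G \<omega>)"
proof
  interpret prob_space M by fact
  note X = assms(2) and exp_margin = assms(4) and ind = assms(5) and Y = assms(6) and conv = assms(7)
  have YM: "Y i \<in> borel_measurable M" if "1 \<le> i" for i
    using ind that by (simp add: indep_vars_def)
  fix \<omega> :: "real ^ 'n" assume \<omega>: "\<omega> \<in> simplex_Sigma"
  have nn: "0 \<le> \<omega> $ j" for j using \<omega> by (simp add: simplex_Sigma_def)
  define p where "p v = prob {w \<in> space M. \<forall>j. \<omega> $ j * v < X w $ j}" for v
  have ev: "{w \<in> space M. \<forall>j\<in>J. \<omega> $ j * v < X w $ j} \<in> events" for v J
    using X by (intro sets.sets_Collect_countable_All') auto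
  have p_mono: "p y \<le> p x" if "0 \<le> x" "x \<le> y" for x y
  proof -
    have "\<omega> $ j * x \<le> \<omega> $ j * y" for j using that nn by (intro mult_left_mono)
    then show ?thesis
      unfolding p_def using ev[of UNIV x] by (intro finite_measure_mono) (auto intro: le_less_trans)
  qed
  have p_nn: "0 \<le> p v" for v by (simp add: p_def)
  have p: "p v = l \<omega> (exp v) * exp (- lam \<omega> * v)" if "0 \<le> v" for v
    using assms(10)[OF \<omega> that] by (simp add: p_def)
  note sv = assms(8)[OF \<omega>]
  have m: "0 < max_coord \<omega>" by (rule max_coord_pos[OF \<omega>])
  \<comment> \<open>Otherwise \<open>s = 1 / max_coord \<omega>\<close> would make
    \<open>n * p (s * ln n)\<close> unbounded, whereas the coordinate attaining the maximum alone
    gives \<open>p (s * ln n) \<le> P(X j > ln n) = 1 / n\<close>. Any constant above 1 could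
    replace 2 below.\<close>
  have lam_ge: "max_coord \<omega> \<le> lam \<omega>"
  proof (rule ccontr)
    assume "\<not> max_coord \<omega> \<le> lam \<omega>"
    then have "filterlim (\<lambda>n. real n * p (1 / max_coord \<omega> * ln (real n))) at_top sequentially"
      using m by (intro tail_at_log_large[OF p_mono sv p]) auto
    then have "eventually (\<lambda>n. 2 \<le> real n * p (1 / max_coord \<omega> * ln (real n))) sequentially"
      by (simp add: filterlim_at_top)
    then have "eventually (\<lambda>n. 2 \<le> real n * p (1 / max_coord \<omega> * ln (real n)) \<and> 1 \<le> n) sequentially"
      using eventually_ge_at_top[of 1] by eventually_elim auto
    then obtain n where n: "2 \<le> real n * p (1 / max_coord \<omega> * ln (real n))" "1 \<le> n"
      unfolding eventually_sequentially by blast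
    obtain j where j: "\<omega> $ j = max_coord \<omega>" using max_coord_attained by blast
    have "p (1 / max_coord \<omega> * ln (real n)) \<le> prob {w \<in> space M. ln (real n) < X w $ j}"
      unfolding p_def using m j X by (intro finite_measure_mono) (auto dest!: spec[of _ j])
    also have "\<dots> = exp (- ln (real n))"
      using exponential_distributedD_gt[OF exp_margin[of j], of "ln (real n)"] n by simp
    also have "\<dots> = 1 / real n" using n by (simp add: exp_minus field_simps)
    finally show False using n by (simp add: field_simps)
  qed
  have "r_min G \<omega> = max_coord \<omega> / lam \<omega>"
  proof (rule r_min_eqI[OF \<omega> lam_ge])
    fix s assume s: "0 < s" "lam \<omega> * s < 1"
    have "filterlim (\<lambda>n. real n * p (s * ln (real n))) at_top sequentially"
      by (rule tail_at_log_large[OF p_mono sv p s])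
    then show "\<exists>g\<in>G. \<forall>j. \<omega> $ j * s \<le> g $ j"
      unfolding p_def by (rule limit_set_meets_closed_orthant[OF ind Y X conv, rotated])
  next
    fix s g assume s: "1 < lam \<omega> * s" and g: "g \<in> G" "\<And>j. \<omega> $ j \<noteq> 0 \<Longrightarrow> \<omega> $ j * s < g $ j"
    have "0 < lam \<omega>" using m lam_ge by simp
    with s have s0: "0 < s" by (smt (verit) mult_nonneg_nonpos)
    \<comment> \<open>For \<open>\<omega> $ j = 0\<close> the event demands
      \<open>0 < X w $ j\<close>, which holds almost surely by the exponential margin. Hence
      \<open>p\<close> is unchanged when only the nonzero coordinates are constrained.\<close>
    have X_pos: "AE w in M. 0 < X w $ j" for j
    proof (rule prob_Collect_eq_1[THEN iffD1])
      show "{w \<in> space M. 0 < X w $ j} \<in> events" using X by auto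
      show "prob {w \<in> space M. 0 < X w $ j} = 1"
        using exponential_distributedD_gt[OF exp_margin[of j], of 0] by simp
    qed
    have "p v = prob {w \<in> space M. \<forall>j\<in>{j. \<omega> $ j \<noteq> 0}. \<omega> $ j * v < X w $ j}" for v
    proof -
      have "AE w in M. \<forall>j. 0 < X w $ j" using X_pos by (subst AE_all_countable) auto
      then have "AE w in M. (\<forall>j. \<omega> $ j * v < X w $ j) \<longleftrightarrow> (\<forall>j\<in>{j. \<omega> $ j \<noteq> 0}. \<omega> $ j * v < X w $ j)"
        by eventually_elim (metis mem_Collect_eq mult_zero_left)
      then have "AE w in M. w \<in> {w \<in> space M. \<forall>j\<in>UNIV. \<omega> $ j * v < X w $ j} \<longleftrightarrow>
          w \<in> {w \<in> space M. \<forall>j\<in>{j. \<omega> $ j \<noteq> 0}. \<omega> $ j * v < X w $ j}"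
        by eventually_elim blast
      from finite_measure_eq_AE[OF this ev ev] show ?thesis by (simp only: p_def ball_UNIV)
    qed
    moreover have "(\<lambda>n. real n * p (s * ln (real n))) \<longlonglongrightarrow> 0"
      by (rule tail_at_log_small[OF p_mono p_nn sv p s0 s])
    ultimately have "(\<lambda>n. real n * prob {w \<in> space M. \<forall>j\<in>{j. \<omega> $ j \<noteq> 0}.
        \<omega> $ j * (s * ln (real n)) < X w $ j}) \<longlonglongrightarrow> 0"
      by (simp only:)
    from limit_set_avoids_open_orthant[OF YM Y X conv this g(1)] g(2) show False by simp
  qed
  \<comment> \<open>Positivity of \<open>r_min\<close> makes \<open>inverse\<close> a genuine
    reciprocal instead of the default \<open>inverse 0 = 0\<close>.\<close>
  then show "0 < r_min G \<omega> \<and> lam \<omega> = max_coord \<omega> * inverse (r_min G \<omega>)"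
    using m lam_ge by simp
qed

end
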